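(* Let $(N,t)$ be a labelled arboreal network on $X$ and $d=d_{(N,t)}$. The following are equivalent: (i) $(N,t)$ is discriminating; (ii) the assignment $\phi(v)=C(v)$ defines a bijection $\phi$ from $V(N)-X$ to $\mathcal C(K(G_d))\cup\mathcal M(d)$.
   Context: $X$ is finite with $|X|\ge2$, $M$ a non-empty set, $\odot\notin M$. In a digraph, a leaf is a vertex of indegree 1 and outdegree 0, a root is a vertex of indegree 0. A network on $X$ is a simple acyclic digraph $N$ whose underlying undirected graph is connected, whose set of leaves is $X$, in which every vertex of indegree 0 has outdegree at least 2, every vertex of outdegree 0 has indegree 1, and no vertex has both indegree and outdegree equal to 1. $N$ is arboreal if its underlying undirected graph is a tree. $v$ is an ancestor of $w$ if there is a directed path (possibly of length 0) from $v$ to $w$; $C(v)$ is the set of leaves having $v$ as ancestor. A least common ancestor of leaves $x,y$ is an ancestor of both none of whose children is an ancestor of both; in arboreal networks it is unique when $x,y$ share an ancestor, denoted $\mathrm{lca}_N(x,y)$. A labelled arboreal network $(N,t)$: $N$ arboreal network on $X$, $t$ a map from the vertices of outdegree $\ge2$ to $M$. $d_{(N,t)}:\binom X2\to M\cup\{\odot\}$ is $d_{(N,t)}(x,y)=t(\mathrm{lca}_N(x,y))$ if $x,y$ share an ancestor, $\odot$ otherwise. An internal arc is an arc neither of whose endpoints is a leaf; $(N,t)$ is discriminating if $N$ has no internal arc $(u,v)$ with $u$ of outdegree 1 and no internal arc $(u,v)$ with $v$ of indegree 1 and $t(u)=t(v)$. $G_d$ is the graph on $X$ with $x\ne y$ adjacent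 iff $d(x,y)\ne\odot$. A clique is a set of $\ge2$ pairwise adjacent vertices; $K(G)$ is the set of maximal cliques. $\mathcal C(K)=\{\bigcap_{Y\in S}Y:\emptyset\ne S\subseteq K,\ \bigcap_{Y\in S}Y\neq\emptyset\}$. A non-empty $Y\subseteq X$ is a clique-module of $d$ if $|Y|=1$, or $Y$ is a clique in $G_d$ and for all $x,y\in Y$, $z\in X-Y$: $|\{d(x,z),d(y,z),\odot\}|\le2$. It is trivial if $|Y|=1$, and strong if for every clique-module $Y'$ of $d$ with $Y\cup Y'$ a clique in $G_d$, $Y\cap Y'\in\{Y,Y',\emptyset\}$. $\mathcal M(d)$ is the set of strong non-trivial clique-modules of $d$. *)

theory Defs
  imports "Graph_Theory.Graph_Theory" "HOL-Library.FuncSet"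
begin

definition leaves :: "('v, 'e) pre_digraph \<Rightarrow> 'v set" where
  "leaves N = {v \<in> verts N. in_degree N v = 1 \<and> out_degree N v = 0}"

(* The locale digraph comprises finiteness and the absence of loops and parallel arcs;
   connected refers to the underlying undirected graph. *)
definition network :: "'v set \<Rightarrow> ('v, 'e) pre_digraph \<Rightarrow> bool" where
  "network X N \<longleftrightarrow>
     digraph N \<and>
     (\<nexists>p. pre_digraph.cycle N p) \<and>
     connected N \<and>
     leaves N = X \<and>
     (\<forall>v \<in> verts N. in_degree N v = 0 \<longrightarrow> out_degree N v \<ge> 2) \<and>
     (\<forall>v \<in> verts N. out_degree N v = 0 \<longrightarrow> in_degree N v = 1) \<and>
     (\<forall>v \<in> verts N. \<not> (in_degree N v = 1 \<and> out_degree N v = 1))"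

(* The library models an undirected graph as a symmetric digraph, in which each edge gives
   a directed cycle of length 2; the cycles of the underlying undirected graph are those of
   length at least 3. (The library predicates forest and tree are about directed cycles.) *)
definition undirected_tree :: "('v, 'e) pre_digraph \<Rightarrow> bool" where
  "undirected_tree N \<longleftrightarrow>
     connected N \<and>
     (\<nexists>p. pre_digraph.cycle (with_proj (mk_symmetric N)) p \<and> length p \<ge> 3)"

definition arboreal_network :: "'v set \<Rightarrow> ('v, 'e) pre_digraph \<Rightarrow> bool" where
  "arboreal_network X N \<longleftrightarrow> network X N \<and> undirected_tree N"

definition leaves_below :: "('v, 'e) pre_digraph \<Rightarrow> 'v \<Rightarrow> 'v set" where
  "leaves_below N v = {x \<in> leaves N. v \<rightarrow>\<^sup>*\<^bsub>N\<^esub> x}"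

definition common_ancestor :: "('v, 'e) pre_digraph \<Rightarrow> 'v \<Rightarrow> 'v \<Rightarrow> 'v \<Rightarrow> bool" where
  "common_ancestor N x y v \<longleftrightarrow> v \<rightarrow>\<^sup>*\<^bsub>N\<^esub> x \<and> v \<rightarrow>\<^sup>*\<^bsub>N\<^esub> y"

definition is_lca :: "('v, 'e) pre_digraph \<Rightarrow> 'v \<Rightarrow> 'v \<Rightarrow> 'v \<Rightarrow> bool" where
  "is_lca N x y v \<longleftrightarrow>
     common_ancestor N x y v \<and> (\<forall>w. v \<rightarrow>\<^bsub>N\<^esub> w \<longrightarrow> \<not> common_ancestor N x y w)"

definition lca :: "('v, 'e) pre_digraph \<Rightarrow> 'v \<Rightarrow> 'v \<Rightarrow> 'v" where
  "lca N x y = (THE v. is_lca N x y v)"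

definition labelled_arboreal_network ::
    "'v set \<Rightarrow> 'm set \<Rightarrow> ('v, 'e) pre_digraph \<Rightarrow> ('v \<Rightarrow> 'm) \<Rightarrow> bool" where
  "labelled_arboreal_network X M N t \<longleftrightarrow>
     arboreal_network X N \<and> t \<in> {v \<in> verts N. out_degree N v \<ge> 2} \<rightarrow> M"

(* A map on 2-element subsets of X is rendered as a symmetric binary function, of which only
   the values at distinct elements of X are used. The argument odot is the extra symbol
   outside M. *)
definition network_map :: "'m \<Rightarrow> ('v, 'e) pre_digraph \<Rightarrow> ('v \<Rightarrow> 'm) \<Rightarrow> 'v \<Rightarrow> 'v \<Rightarrow> 'm" where
  "network_map odot N t x y =
     (if \<exists>v. common_ancestor N x y v then t (lca N x y) else odot)"

definition internal_arc :: "('v, 'e) pre_digraph \<Rightarrow> 'v \<Rightarrow> 'v \<Rightarrow> bool" where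
  "internal_arc N u v \<longleftrightarrow> u \<rightarrow>\<^bsub>N\<^esub> v \<and> u \<notin> leaves N \<and> v \<notin> leaves N"

(* In a network without internal arcs (u, v) such that u has outdegree 1, both ends of an
   internal arc whose head has indegree 1 have outdegree at least 2, so the values of t outside
   the vertices of outdegree at least 2 do not affect this predicate. *)
definition discriminating :: "('v, 'e) pre_digraph \<Rightarrow> ('v \<Rightarrow> 'm) \<Rightarrow> bool" where
  "discriminating N t \<longleftrightarrow>
     (\<nexists>u v. internal_arc N u v \<and> out_degree N u = 1) \<and>
     (\<nexists>u v. internal_arc N u v \<and> in_degree N v = 1 \<and> t u = t v)"

definition map_graph :: "'m \<Rightarrow> 'v set \<Rightarrow> ('v \<Rightarrow> 'v \<Rightarrow> 'm) \<Rightarrow> 'v pair_pre_digraph" where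
  "map_graph odot X d =
     \<lparr> pverts = X, parcs = {(x, y). x \<in> X \<and> y \<in> X \<and> x \<noteq> y \<and> d x y \<noteq> odot} \<rparr>"

definition clique :: "'v pair_pre_digraph \<Rightarrow> 'v set \<Rightarrow> bool" where
  "clique G Y \<longleftrightarrow>
     Y \<subseteq> pverts G \<and> card Y \<ge> 2 \<and> (\<forall>x\<in>Y. \<forall>y\<in>Y. x \<noteq> y \<longrightarrow> (x, y) \<in> parcs G)"

definition maximal_cliques :: "'v pair_pre_digraph \<Rightarrow> 'v set set" where
  "maximal_cliques G = {Y. clique G Y \<and> (\<forall>Z. clique G Z \<longrightarrow> Y \<subseteq> Z \<longrightarrow> Z = Y)}"

definition nonempty_intersections :: "'v set set \<Rightarrow> 'v set set" where
  "nonempty_intersections K = {\<Inter>S | S. S \<noteq> {} \<and> S \<subseteq> K \<and> \<Inter>S \<noteq> {}}"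

definition clique_module :: "'m \<Rightarrow> 'v set \<Rightarrow> ('v \<Rightarrow> 'v \<Rightarrow> 'm) \<Rightarrow> 'v set \<Rightarrow> bool" where
  "clique_module odot X d Y \<longleftrightarrow>
     Y \<noteq> {} \<and> Y \<subseteq> X \<and>
     (card Y = 1 \<or>
      clique (map_graph odot X d) Y \<and>
      (\<forall>x\<in>Y. \<forall>y\<in>Y. \<forall>z\<in>X - Y. card {d x z, d y z, odot} \<le> 2))"

definition strong_clique_module :: "'m \<Rightarrow> 'v set \<Rightarrow> ('v \<Rightarrow> 'v \<Rightarrow> 'm) \<Rightarrow> 'v set \<Rightarrow> bool" where
  "strong_clique_module odot X d Y \<longleftrightarrow>
     clique_module odot X d Y \<and>
     (\<forall>Y'. clique_module odot X d Y' \<longrightarrow> clique (map_graph odot X d) (Y \<union> Y') \<longrightarrow>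
        Y \<inter> Y' \<in> {Y, Y', {}})"

definition strong_nontrivial_clique_modules ::
    "'m \<Rightarrow> 'v set \<Rightarrow> ('v \<Rightarrow> 'v \<Rightarrow> 'm) \<Rightarrow> 'v set set" where
  "strong_nontrivial_clique_modules odot X d = {Y. strong_clique_module odot X d Y \<and> card Y \<noteq> 1}"

end

theory Submission
  imports Defs
begin

text \<open>
  Every arc of an arboreal network is a bridge. Hence ancestor sets have the Helly property, and
  two vertices with a common descendant have as common descendants exactly the descendants of one
  vertex. So the maximal cliques are the sets $C(r)$ for roots $r$, their non-empty intersections
  are sets $C(v)$, and every $C(v)$ is a clique-module: if $z$ shares ancestors with
  $x, y \in C(v)$ but is not in $C(v)$, then $x, y, z$ share an ancestor, so
  lca$(x,z)$ = lca$(y,z)$. A strong clique-module $Y$ with lowest common ancestor $v$ equals $C(v)$,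
  since otherwise it overlaps the union of two child clusters of $v$.

  If $v$ is a root or has indegree at least 2, then $C(v)$ is an intersection of maximal cliques.
  If $v$ has a single parent $u$, then $t(u) \neq t(v)$ forces $C(v)$ to be strong, while
  $t(u) = t(v)$ makes the union of a child cluster of $v$ and another child cluster of $u$ a
  clique-module that overlaps $C(v)$.
\<close>

section \<open>Acyclic relations all of whose arcs are bridges\<close>

locale polytree =
  fixes E :: "('v \<times> 'v) set"
  assumes finite_E: "finite E"
    and acyclic_E: "acyclic E"
    and bridge: "(u, v) \<in> E \<Longrightarrow> (u, v) \<notin> ((E - {(u, v)}) \<union> (E - {(u, v)})\<inverse>)\<^sup>*"
begin

abbreviation ancestor :: "'v \<Rightarrow> 'v \<Rightarrow> bool" (infix "\<preceq>" 50) where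
  "a \<preceq> b \<equiv> (a, b) \<in> E\<^sup>*"

definition linked :: "'v \<times> 'v \<Rightarrow> ('v \<times> 'v) set" where
  "linked e = ((E - {e}) \<union> (E - {e})\<inverse>)\<^sup>*"

lemma linked_sym: "(a, b) \<in> linked e \<Longrightarrow> (b, a) \<in> linked e"
proof -
  have "sym (linked e)"
    unfolding linked_def by (intro sym_rtrancl) (auto simp: sym_def)
  then show "(a, b) \<in> linked e \<Longrightarrow> (b, a) \<in> linked e" by (auto dest: symD)
qed

lemma linked_trans [trans]: "(a, b) \<in> linked e \<Longrightarrow> (b, c) \<in> linked e \<Longrightarrow> (a, c) \<in> linked e"
  unfolding linked_def by (rule rtrancl_trans)

lemma arc_not_linked: "(p, w) \<in> E \<Longrightarrow> (p, w) \<notin> linked (p, w)"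
  using bridge unfolding linked_def .

lemma linked_arc: "(a, b) \<in> E \<Longrightarrow> (a, b) \<noteq> e \<Longrightarrow> (a, b) \<in> linked e"
  unfolding linked_def by auto

lemma linked_path: "a \<preceq> b \<Longrightarrow> \<not> (a \<preceq> p \<and> w \<preceq> b) \<Longrightarrow> (a, b) \<in> linked (p, w)"
proof (induction rule: rtrancl_induct)
  case base
  then show ?case by (simp add: linked_def)
next
  case (step y z)
  have "(a, y) \<in> linked (p, w)"
    using step by (meson rtrancl.rtrancl_into_rtrancl)
  moreover have "(y, z) \<in> linked (p, w)"
    using step by (intro linked_arc) auto
  ultimately show ?case by (rule linked_trans)
qed

lemma ancestor_antisym: "a \<preceq> b \<Longrightarrow> b \<preceq> a \<Longrightarrow> a = b"
  using acyclic_impl_antisym_rtrancl[OF acyclic_E] by (auto dest: antisymD)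

lemma arc_not_back: "(u, v) \<in> E \<Longrightarrow> \<not> v \<preceq> u"
  using acyclic_E unfolding acyclic_def by (meson rtrancl_into_trancl2)

lemma children_disjoint:
  assumes "(u, v1) \<in> E" "(u, v2) \<in> E" "v1 \<preceq> x" "v2 \<preceq> x"
  shows "v1 = v2"
proof (rule ccontr)
  assume "v1 \<noteq> v2"
  then have "(u, v2) \<in> linked (u, v1)"
    using assms by (auto intro: linked_arc)
  also have "(v2, x) \<in> linked (u, v1)"
    using assms arc_not_back by (auto intro: linked_path)
  also have "(x, v1) \<in> linked (u, v1)"
    using assms arc_not_back by (auto intro: linked_sym linked_path)
  finally show False using arc_not_linked assms(1) by blast
qed

lemma ancestors_comparable:
  "r \<preceq> a \<Longrightarrow> a \<preceq> x \<Longrightarrow> r \<preceq> b \<Longrightarrow> b \<preceq> x \<Longrightarrow> a \<preceq> b \<or> b \<preceq> a"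
proof (induction rule: converse_rtrancl_induct)
  case base
  then show ?case by simp
next
  case (step r r')
  show ?case
  proof (cases "r = b")
    case True
    then show ?thesis using step by (meson converse_rtrancl_into_rtrancl)
  next
    case False
    then obtain r'' where "(r, r'') \<in> E" "r'' \<preceq> b"
      using step.prems by (meson converse_rtranclE)
    moreover have "r' = r''"
      using children_disjoint[of r r' r'' x] calculation step by (meson rtrancl_trans)
    ultimately show ?thesis using step by simp
  qed
qed

lemma parents_eq:
  assumes "a \<preceq> p" "a \<preceq> q" "(p, v) \<in> E" "(q, v) \<in> E"
  shows "p = q"
proof -
  have wlog: "p = q" if pq: "p \<preceq> q" "(p, v) \<in> E" "(q, v) \<in> E" for p q
  proof (rule ccontr)
    assume "p \<noteq> q"
    then obtain c where c: "(p, c) \<in> E" "c \<preceq> q"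
      using pq by (meson converse_rtranclE)
    then have "c = v"
      using children_disjoint[of p c v v] pq by (meson rtrancl.simps)
    then show False using c pq arc_not_back by blast
  qed
  have "p \<preceq> q \<or> q \<preceq> p"
    using ancestors_comparable[of a p v q] assms by blast
  then show ?thesis using wlog assms by metis
qed

lemma crossing_arc:
  assumes "a \<preceq> y" "\<not> P a" "P y"
  obtains p w where "(p, w) \<in> E" "a \<preceq> p" "w \<preceq> y" "\<not> P p" "P w"
proof -
  have "\<exists>p w. (p, w) \<in> E \<and> a \<preceq> p \<and> w \<preceq> y \<and> \<not> P p \<and> P w"
    using assms
  proof (induction rule: converse_rtrancl_induct)
    case base
    then show ?case by simp
  next
    case (step a b)
    then show ?case by (meson converse_rtrancl_into_rtrancl rtrancl.rtrancl_refl)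
  qed
  then show ?thesis using that by blast
qed

lemma common_descendants:
  assumes "u \<preceq> x" "v \<preceq> x"
  shows "\<exists>w. \<forall>y. (u \<preceq> y \<and> v \<preceq> y) \<longleftrightarrow> w \<preceq> y"
proof (cases "v \<preceq> u")
  case True
  then show ?thesis by (meson rtrancl_trans)
next
  case False
  obtain p w where pw: "(p, w) \<in> E" "u \<preceq> p" "w \<preceq> x" "\<not> v \<preceq> p" "v \<preceq> w"
    using crossing_arc[of u x "\<lambda>y. v \<preceq> y"] assms False by blast
  have uw: "u \<preceq> w" using pw by (meson rtrancl.rtrancl_into_rtrancl)
  have "w \<preceq> y" if y: "u \<preceq> y" "v \<preceq> y" for y
  proof (rule ccontr)
    assume nw: "\<not> w \<preceq> y"
    have "(p, u) \<in> linked (p, w)"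
      using pw arc_not_back by (auto intro: linked_sym linked_path)
    also have "(u, y) \<in> linked (p, w)"
      using y nw by (auto intro: linked_path)
    also have "(y, v) \<in> linked (p, w)"
      using y nw by (auto intro: linked_sym linked_path)
    also have "(v, w) \<in> linked (p, w)"
      using pw by (auto intro: linked_path)
    finally show False using arc_not_linked pw(1) by blast
  qed
  then show ?thesis using uw pw(5) by (meson rtrancl_trans)
qed

lemma helly_three:
  assumes "a \<preceq> x" "a \<preceq> y" "b \<preceq> y" "b \<preceq> z" "c \<preceq> x" "c \<preceq> z"
  shows "\<exists>r. r \<preceq> x \<and> r \<preceq> y \<and> r \<preceq> z"
proof (rule ccontr)
  assume no: "\<not> ?thesis"
  then have "\<not> b \<preceq> a" using assms by (meson rtrancl_trans)
  then obtain p w where pw: "(p, w) \<in> E" "a \<preceq> p" "w \<preceq> y" "\<not> b \<preceq> p" "b \<preceq> w"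
    using crossing_arc[of a y "\<lambda>y. b \<preceq> y"] assms by blast
  have nwx: "\<not> w \<preceq> x" using no pw assms by (meson rtrancl_trans)
  have ncp: "\<not> c \<preceq> p"
    using no pw assms by (meson rtrancl.rtrancl_into_rtrancl rtrancl_trans)
  have "(p, a) \<in> linked (p, w)"
    using pw arc_not_back by (auto intro: linked_sym linked_path)
  also have "(a, x) \<in> linked (p, w)"
    using assms nwx by (auto intro: linked_path)
  also have "(x, c) \<in> linked (p, w)"
    using assms ncp by (auto intro: linked_sym linked_path)
  also have "(c, z) \<in> linked (p, w)"
    using assms ncp by (auto intro: linked_path)
  also have "(z, b) \<in> linked (p, w)"
    using assms pw by (auto intro: linked_sym linked_path)
  also have "(b, w) \<in> linked (p, w)"
    using pw by (auto intro: linked_path)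
  finally show False using arc_not_linked pw(1) by blast
qed

definition lowest_common :: "'v \<Rightarrow> 'v \<Rightarrow> 'v \<Rightarrow> bool" where
  "lowest_common x y m \<longleftrightarrow> m \<preceq> x \<and> m \<preceq> y \<and> (\<forall>a. a \<preceq> x \<longrightarrow> a \<preceq> y \<longrightarrow> a \<preceq> m)"

lemma lowest_common_commute: "lowest_common x y m \<Longrightarrow> lowest_common y x m"
  unfolding lowest_common_def by blast

lemma lowest_common_unique: "lowest_common x y m \<Longrightarrow> lowest_common x y m' \<Longrightarrow> m = m'"
  unfolding lowest_common_def by (blast intro: ancestor_antisym)

lemma lowest_common_iff:
  "lowest_common x y m \<longleftrightarrow>
     m \<preceq> x \<and> m \<preceq> y \<and> (\<forall>w. (m, w) \<in> E \<longrightarrow> \<not> (w \<preceq> x \<and> w \<preceq> y))"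
proof (intro iffI conjI allI impI notI)
  fix w assume "lowest_common x y m" "(m, w) \<in> E" "w \<preceq> x \<and> w \<preceq> y"
  then show False using arc_not_back unfolding lowest_common_def by blast
next
  assume m: "m \<preceq> x \<and> m \<preceq> y \<and> (\<forall>w. (m, w) \<in> E \<longrightarrow> \<not> (w \<preceq> x \<and> w \<preceq> y))"
  have "a \<preceq> m" if a: "a \<preceq> x" "a \<preceq> y" for a
  proof -
    obtain w where w: "\<And>y. (a \<preceq> y \<and> m \<preceq> y) \<longleftrightarrow> w \<preceq> y"
      using common_descendants a(1) m by metis
    have "m = w"
    proof (rule ccontr)
      assume "m \<noteq> w"
      moreover have "m \<preceq> w" using w by blast
      ultimately obtain c where "(m, c) \<in> E" "c \<preceq> w" by (meson converse_rtranclE)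
      then show False using m a w by (meson rtrancl_trans)
    qed
    then show ?thesis using w by blast
  qed
  then show "lowest_common x y m" using m unfolding lowest_common_def by blast
qed (auto simp: lowest_common_def)

lemma lowest_common_exists:
  assumes "a \<preceq> x" "a \<preceq> y"
  shows "\<exists>m. lowest_common x y m"
proof -
  have "wf (E\<inverse>)" using finite_acyclic_wf_converse[OF finite_E acyclic_E] .
  from wfE_min[OF this, of a "{m. m \<preceq> x \<and> m \<preceq> y}"] assms
  show ?thesis unfolding lowest_common_iff by auto
qed

lemma helly:
  assumes "finite Y" "\<And>x y. x \<in> Y \<Longrightarrow> y \<in> Y \<Longrightarrow> \<exists>a. a \<preceq> x \<and> a \<preceq> y"
    "\<And>y. y \<in> Y \<Longrightarrow> \<exists>a. a \<preceq> m \<and> a \<preceq> y"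
  shows "\<exists>a. a \<preceq> m \<and> (\<forall>y\<in>Y. a \<preceq> y)"
  using assms
proof (induction arbitrary: m rule: finite_induct)
  case empty
  then show ?case by blast
next
  case (insert y Y)
  obtain m' where m': "lowest_common m y m'"
    using lowest_common_exists insert.prems(2) by blast
  have "\<exists>a. a \<preceq> m' \<and> a \<preceq> z" if z: "z \<in> Y" for z
  proof -
    obtain a b c where "a \<preceq> m \<and> a \<preceq> y" "b \<preceq> y \<and> b \<preceq> z" "c \<preceq> m \<and> c \<preceq> z"
      using insert.prems(1)[of y z] insert.prems(2)[of y] insert.prems(2)[of z] z by auto
    then obtain r where "r \<preceq> m \<and> r \<preceq> y \<and> r \<preceq> z"
      using helly_three[of a m y b z c] by blast
    then show ?thesis using m' unfolding lowest_common_def by blast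
  qed
  then obtain a where a: "a \<preceq> m'" "\<forall>y\<in>Y. a \<preceq> y"
    using insert.IH[of m'] insert.prems(1) by blast
  moreover have "a \<preceq> m" "a \<preceq> y"
    using a(1) m' unfolding lowest_common_def by (auto intro: rtrancl_trans)
  ultimately show ?case by blast
qed

lemma lowest_common_outside:
  assumes xy: "lowest_common x y m" and nz: "\<not> m \<preceq> z"
    and xz: "lowest_common x z w" and yz: "lowest_common y z w'"
  shows "w = w'"
proof -
  obtain r where r: "r \<preceq> x" "r \<preceq> y" "r \<preceq> z"
    using helly_three[of m x y w' z w] assms unfolding lowest_common_def by blast
  have le: "r \<preceq> m" "r \<preceq> w" "r \<preceq> w'" using r assms unfolding lowest_common_def by blast+
  have "w \<preceq> m"
    using ancestors_comparable[of r m x w] le assms unfolding lowest_common_def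
    by (meson rtrancl_trans)
  moreover have "w' \<preceq> m"
    using ancestors_comparable[of r m y w'] le assms unfolding lowest_common_def
    by (meson rtrancl_trans)
  ultimately show ?thesis
    using assms unfolding lowest_common_def by (meson ancestor_antisym rtrancl_trans)
qed

lemma lowest_common_children:
  assumes "(v, v1) \<in> E" "(v, v2) \<in> E" "v1 \<noteq> v2" "v1 \<preceq> x" "v2 \<preceq> y"
  shows "lowest_common x y v"
  unfolding lowest_common_iff
proof (intro conjI allI impI notI)
  show "v \<preceq> x" "v \<preceq> y" using assms by (meson converse_rtrancl_into_rtrancl)+
  fix w assume "(v, w) \<in> E" "w \<preceq> x \<and> w \<preceq> y"
  then show False using assms children_disjoint by metis
qed

end

section \<open>Clusters and clique-modules\<close>

lemma card_triple_le_2: "card {a, b, c} \<le> 2 \<longleftrightarrow> a = b \<or> a = c \<or> b = c"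
  by (auto simp: card_insert_if)

locale labelled_polytree = polytree E for E :: "('v \<times> 'v) set" +
  fixes V X :: "'v set" and t :: "'v \<Rightarrow> 'm" and odot :: 'm and d :: "'v \<Rightarrow> 'v \<Rightarrow> 'm"
  assumes finite_V: "finite V"
    and E_V: "E \<subseteq> V \<times> V"
    and X_eq: "X = {v \<in> V. \<forall>w. (v, w) \<notin> E}"
    and leaf_parent: "x \<in> X \<Longrightarrow> \<exists>!u. (u, x) \<in> E"
    and root_branching: "v \<in> V \<Longrightarrow> \<forall>u. (u, v) \<notin> E \<Longrightarrow> \<exists>a b. a \<noteq> b \<and> (v, a) \<in> E \<and> (v, b) \<in> E"
    and no_suppressible:
      "(u, v) \<in> E \<Longrightarrow> \<forall>u'. (u', v) \<in> E \<longrightarrow> u' = u \<Longrightarrow> (v, w) \<in> E \<Longrightarrow> \<exists>w'. w' \<noteq> w \<and> (v, w') \<in> E"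
    and d_lca: "x \<in> X \<Longrightarrow> y \<in> X \<Longrightarrow> x \<noteq> y \<Longrightarrow> lowest_common x y m \<Longrightarrow> d x y = t m"
    and d_no_lca: "x \<in> X \<Longrightarrow> y \<in> X \<Longrightarrow> \<nexists>a. a \<preceq> x \<and> a \<preceq> y \<Longrightarrow> d x y = odot"
    and t_odot: "(v, a) \<in> E \<Longrightarrow> (v, b) \<in> E \<Longrightarrow> a \<noteq> b \<Longrightarrow> t v \<noteq> odot"
begin

definition cluster :: "'v \<Rightarrow> 'v set" where
  "cluster v = {x \<in> X. v \<preceq> x}"

abbreviation "G \<equiv> map_graph odot X d"

definition is_root :: "'v \<Rightarrow> bool" where
  "is_root r \<longleftrightarrow> r \<in> V \<and> (\<forall>u. (u, r) \<notin> E)"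

lemma finite_X: "finite X"
  using finite_V X_eq by simp

lemma cluster_subset: "cluster v \<subseteq> X"
  unfolding cluster_def by blast

lemma finite_cluster: "finite (cluster v)"
  using cluster_subset finite_X finite_subset by blast

lemma cluster_mono: "u \<preceq> v \<Longrightarrow> cluster v \<subseteq> cluster u"
  unfolding cluster_def by (auto intro: rtrancl_trans)

lemma cluster_child: "(u, v) \<in> E \<Longrightarrow> cluster v \<subseteq> cluster u"
  by (rule cluster_mono) auto

lemma descendant_V: "u \<preceq> v \<Longrightarrow> u \<in> V \<Longrightarrow> v \<in> V"
  by (induction rule: rtrancl_induct) (use E_V in auto)

lemma ancestor_V: "u \<preceq> v \<Longrightarrow> v \<in> V \<Longrightarrow> u \<in> V"
  by (induction rule: converse_rtrancl_induct) (use E_V in auto)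

lemma leaf_V: "x \<in> X \<Longrightarrow> x \<in> V"
  using X_eq by blast

lemma leaf_descendant: "x \<in> X \<Longrightarrow> x \<preceq> y \<Longrightarrow> y = x"
  using X_eq by (metis (mono_tags, lifting) converse_rtranclE mem_Collect_eq)

lemma internal_child: "v \<in> V - X \<Longrightarrow> \<exists>w. (v, w) \<in> E"
  using X_eq by blast

lemma parent_internal: "(v, w) \<in> E \<Longrightarrow> v \<in> V - X"
  using X_eq E_V by blast

lemma cluster_nonempty:
  assumes "v \<in> V"
  shows "cluster v \<noteq> {}"
proof -
  have "wf (E\<inverse>)" using finite_acyclic_wf_converse[OF finite_E acyclic_E] .
  then obtain x where x: "v \<preceq> x" "\<And>y. (x, y) \<in> E \<Longrightarrow> \<not> v \<preceq> y"
    using wfE_min[of "E\<inverse>" v "{x. v \<preceq> x}"] by auto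
  then have "x \<in> X"
    using X_eq descendant_V[OF x(1) assms] by (auto intro: rtrancl_into_rtrancl)
  then show ?thesis using x unfolding cluster_def by blast
qed

lemma root_above:
  assumes "v \<in> V"
  obtains r where "is_root r" "r \<preceq> v"
proof -
  have "wf E" using finite_acyclic_wf[OF finite_E acyclic_E] .
  then obtain r where r: "r \<preceq> v" "\<And>y. (y, r) \<in> E \<Longrightarrow> \<not> y \<preceq> v"
    using wfE_min[of E v "{r. r \<preceq> v}"] by auto
  then have "is_root r"
    using ancestor_V[OF r(1) assms] unfolding is_root_def by (auto intro: converse_rtrancl_into_rtrancl)
  then show ?thesis using r that by blast
qed

lemma ancestor_parent: "u \<preceq> v \<Longrightarrow> u \<noteq> v \<Longrightarrow> \<exists>p. u \<preceq> p \<and> (p, v) \<in> E"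
  by (meson rtranclE)

lemma ancestor_child: "u \<preceq> v \<Longrightarrow> u \<noteq> v \<Longrightarrow> \<exists>c. (u, c) \<in> E \<and> c \<preceq> v"
  by (meson converse_rtranclE)

lemma cluster_child_cases:
  assumes "x \<in> cluster v" "v \<notin> X"
  obtains c where "(v, c) \<in> E" "x \<in> cluster c"
  using assms ancestor_child[of v x] unfolding cluster_def by blast

lemma lowest_common_clusters:
  assumes "(v, a) \<in> E" "(v, b) \<in> E" "a \<noteq> b" "x \<in> cluster a" "y \<in> cluster b"
  shows "lowest_common x y v"
  using assms lowest_common_children unfolding cluster_def by blast

lemma children_clusters_disjoint:
  "(v, a) \<in> E \<Longrightarrow> (v, b) \<in> E \<Longrightarrow> a \<noteq> b \<Longrightarrow> cluster a \<inter> cluster b = {}"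
  unfolding cluster_def using children_disjoint by blast

lemma d_children:
  assumes "(v, a) \<in> E" "(v, b) \<in> E" "a \<noteq> b" "x \<in> cluster a" "y \<in> cluster b"
  shows "d x y = t v"
proof (rule d_lca)
  show "lowest_common x y v" using lowest_common_clusters assms by blast
  show "x \<noteq> y" using children_clusters_disjoint assms by blast
qed (use assms cluster_subset in auto)

lemma child_cluster_psubset:
  assumes "(v, a) \<in> E" "(v, b) \<in> E" "a \<noteq> b"
  shows "cluster a \<subset> cluster v"
proof -
  have "b \<in> V" using assms E_V by blast
  then obtain y where "y \<in> cluster b" using cluster_nonempty by blast
  then show ?thesis
    using cluster_child[OF assms(1)] cluster_child[OF assms(2)] children_clusters_disjoint[OF assms] by blast
qed

lemma only_child_cluster:
  assumes "(v, a) \<in> E" "\<And>b. (v, b) \<in> E \<Longrightarrow> b = a"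
  shows "cluster v = cluster a"
proof
  show "cluster v \<subseteq> cluster a"
    using assms parent_internal cluster_child_cases by (metis DiffD2 subsetI)
qed (rule cluster_child[OF assms(1)])

lemma branching_ancestor:
  assumes "(v, a) \<in> E" "(v, b) \<in> E" "a \<noteq> b" "cluster v \<subseteq> cluster u"
  shows "u \<preceq> v"
proof -
  have "a \<in> V" "b \<in> V" using assms E_V by blast+
  then obtain x y where xy: "x \<in> cluster a" "y \<in> cluster b" using cluster_nonempty by blast
  then have "lowest_common x y v" using lowest_common_clusters assms by blast
  moreover have "u \<preceq> x" "u \<preceq> y"
    using xy assms cluster_child unfolding cluster_def by blast+
  ultimately show ?thesis unfolding lowest_common_def by blast
qed

lemma lca_branching:
  assumes "x \<in> X" "y \<in> X" "x \<noteq> y" "lowest_common x y m"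
  obtains a b where "a \<noteq> b" "(m, a) \<in> E" "(m, b) \<in> E" "a \<preceq> x" "b \<preceq> y"
proof -
  have "m \<preceq> x" "m \<preceq> y" using assms unfolding lowest_common_def by auto
  moreover have "m \<noteq> x" "m \<noteq> y" using assms calculation leaf_descendant by blast+
  ultimately obtain a b where "(m, a) \<in> E" "a \<preceq> x" "(m, b) \<in> E" "b \<preceq> y"
    using ancestor_child by meson
  moreover from this have "a \<noteq> b" using assms(4) unfolding lowest_common_iff by metis
  ultimately show ?thesis using that by metis
qed

lemma d_odot_iff:
  assumes "x \<in> X" "y \<in> X" "x \<noteq> y"
  shows "d x y = odot \<longleftrightarrow> (\<nexists>a. a \<preceq> x \<and> a \<preceq> y)"
proof
  assume dxy: "d x y = odot"
  show "\<nexists>a. a \<preceq> x \<and> a \<preceq> y"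
  proof
    assume "\<exists>a. a \<preceq> x \<and> a \<preceq> y"
    then obtain m where m: "lowest_common x y m" using lowest_common_exists by blast
    obtain a b where "a \<noteq> b" "(m, a) \<in> E" "(m, b) \<in> E"
      using lca_branching[OF assms m] by blast
    then show False using t_odot d_lca[OF assms m] dxy by metis
  qed
qed (rule d_no_lca[OF assms(1,2)])

lemma d_commute:
  assumes "x \<in> X" "y \<in> X" "x \<noteq> y"
  shows "d x y = d y x"
proof (cases "\<exists>a. a \<preceq> x \<and> a \<preceq> y")
  case True
  then obtain m where "lowest_common x y m" using lowest_common_exists by blast
  then show ?thesis using assms d_lca lowest_common_commute by metis
next
  case False
  then show ?thesis using assms d_no_lca by metis
qed

lemma clique_iff:
  "clique G Y \<longleftrightarrow> Y \<subseteq> X \<and> card Y \<ge> 2 \<and> (\<forall>x\<in>Y. \<forall>y\<in>Y. \<exists>a. a \<preceq> x \<and> a \<preceq> y)"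
proof -
  have adj: "(x \<noteq> y \<longrightarrow> (x, y) \<in> parcs G) \<longleftrightarrow> (\<exists>a. a \<preceq> x \<and> a \<preceq> y)"
    if "x \<in> X" "y \<in> X" for x y
    using d_odot_iff[OF that] that by (cases "x = y") (auto simp: map_graph_def)
  have "pverts G = X" by (simp add: map_graph_def)
  moreover have "(\<forall>x\<in>Y. \<forall>y\<in>Y. x \<noteq> y \<longrightarrow> (x, y) \<in> parcs G) \<longleftrightarrow>
      (\<forall>x\<in>Y. \<forall>y\<in>Y. \<exists>a. a \<preceq> x \<and> a \<preceq> y)" if "Y \<subseteq> X"
    using that by (intro ball_cong refl adj) auto
  ultimately show ?thesis unfolding clique_def by (cases "Y \<subseteq> X") simp_all
qed

lemma clique_in_cluster:
  assumes "Y \<subseteq> cluster v" "card Y \<ge> 2"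
  shows "clique G Y"
  using assms unfolding clique_iff cluster_def by blast

lemma cliqueE:
  assumes "clique G Y"
  obtains r where "is_root r" "Y \<subseteq> cluster r"
proof -
  have Y: "Y \<subseteq> X" "card Y \<ge> 2" "\<And>x y. x \<in> Y \<Longrightarrow> y \<in> Y \<Longrightarrow> \<exists>a. a \<preceq> x \<and> a \<preceq> y"
    using assms unfolding clique_iff by blast+
  then obtain m where m: "m \<in> Y" by fastforce
  have "finite Y" using Y finite_X finite_subset by blast
  then obtain a where a: "a \<preceq> m" "\<forall>y\<in>Y. a \<preceq> y" using helly[of Y m] Y m by blast
  then have "a \<in> V" using m Y leaf_V ancestor_V by blast
  then obtain r where "is_root r" "r \<preceq> a" using root_above by blast
  then show ?thesis using that a Y unfolding cluster_def by (blast intro: rtrancl_trans)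
qed

lemma root_antisym: "is_root r \<Longrightarrow> a \<preceq> r \<Longrightarrow> a = r"
  unfolding is_root_def by (metis rtranclE)

lemma branching_card:
  assumes "(v, a) \<in> E" "(v, b) \<in> E" "a \<noteq> b"
  shows "card (cluster v) \<ge> 2"
proof -
  have "cluster a \<noteq> {}" using assms E_V cluster_nonempty by blast
  then have "card (cluster a) \<ge> 1" using finite_cluster by (simp add: Suc_le_eq card_gt_0_iff)
  then show ?thesis
    using psubset_card_mono[OF finite_cluster child_cluster_psubset[OF assms]] by linarith
qed

lemma root_branchingE:
  assumes "is_root r"
  obtains a b where "(r, a) \<in> E" "(r, b) \<in> E" "a \<noteq> b"
  using assms root_branching unfolding is_root_def by blast

lemma maximal_cliques_eq: "maximal_cliques G = cluster ` {r. is_root r}"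
proof (intro equalityI subsetI)
  fix Y assume "Y \<in> maximal_cliques G"
  then have Y: "clique G Y" "\<And>Z. clique G Z \<Longrightarrow> Y \<subseteq> Z \<Longrightarrow> Z = Y"
    unfolding maximal_cliques_def by auto
  obtain r where r: "is_root r" "Y \<subseteq> cluster r" using Y(1) by (rule cliqueE)
  then have "clique G (cluster r)"
    using branching_card root_branchingE clique_in_cluster by (metis subset_refl)
  then show "Y \<in> cluster ` {r. is_root r}" using Y(2) r by blast
next
  fix Y assume "Y \<in> cluster ` {r. is_root r}"
  then obtain r where r: "is_root r" "Y = cluster r" by blast
  obtain a b where ab: "(r, a) \<in> E" "(r, b) \<in> E" "a \<noteq> b" using root_branchingE r by blast
  have "clique G Y" using branching_card[OF ab] clique_in_cluster r by blast
  moreover have "Z = Y" if Z: "clique G Z" "Y \<subseteq> Z" for Z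
  proof -
    obtain r' where r': "is_root r'" "Z \<subseteq> cluster r'" using Z(1) by (rule cliqueE)
    then have "r' \<preceq> r" using branching_ancestor[OF ab] r Z by blast
    then have "r' = r" using root_antisym r by blast
    then show ?thesis using r' r Z by blast
  qed
  ultimately show "Y \<in> maximal_cliques G" unfolding maximal_cliques_def by blast
qed

lemma root_internal: "is_root r \<Longrightarrow> r \<in> V - X"
  using root_branchingE parent_internal by metis

lemma common_descendants_internal:
  assumes "u \<in> V - X" "v \<in> V - X" "u \<preceq> x" "v \<preceq> x"
  obtains w where "w \<in> V - X" "\<And>y. (u \<preceq> y \<and> v \<preceq> y) \<longleftrightarrow> w \<preceq> y"
proof -
  obtain w where w: "\<And>y. (u \<preceq> y \<and> v \<preceq> y) \<longleftrightarrow> w \<preceq> y"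
    using common_descendants assms(3,4) by metis
  then have uw: "u \<preceq> w" "v \<preceq> w" by blast+
  have "w \<notin> X"
  proof
    assume wX: "w \<in> X"
    then obtain p where p: "(p, w) \<in> E" "\<And>q. (q, w) \<in> E \<Longrightarrow> q = p" using leaf_parent by blast
    have "u \<preceq> p" "v \<preceq> p" using ancestor_parent uw p wX assms by blast+
    then show False using w p(1) arc_not_back by blast
  qed
  moreover have "w \<in> V" using uw(1) descendant_V assms by blast
  ultimately show ?thesis using that w by blast
qed

lemma cluster_Int:
  assumes "u \<in> V - X" "v \<in> V - X" "cluster u \<inter> cluster v \<noteq> {}"
  shows "\<exists>w\<in>V - X. cluster u \<inter> cluster v = cluster w"
proof -
  obtain x where "u \<preceq> x" "v \<preceq> x" using assms(3) unfolding cluster_def by blast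
  then obtain w where w: "w \<in> V - X" "\<And>y. (u \<preceq> y \<and> v \<preceq> y) \<longleftrightarrow> w \<preceq> y"
    using common_descendants_internal[OF assms(1,2)] by metis
  then have "cluster u \<inter> cluster v = cluster w" unfolding cluster_def by blast
  then show ?thesis using w(1) by blast
qed

lemma cluster_Inter:
  assumes "finite S" "S \<noteq> {}" "S \<subseteq> cluster ` (V - X)" "\<Inter>S \<noteq> {}"
  shows "\<Inter>S \<in> cluster ` (V - X)"
  using assms
proof (induction rule: finite_ne_induct)
  case (singleton Y)
  then show ?case by simp
next
  case (insert Y S)
  then obtain u v where "u \<in> V - X" "Y = cluster u" "v \<in> V - X" "\<Inter>S = cluster v" by auto
  then show ?case using cluster_Int[of u v] insert.prems by auto
qed

lemma nonempty_intersections_subset: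
  "nonempty_intersections (maximal_cliques G) \<subseteq> cluster ` (V - X)"
proof
  fix Y assume "Y \<in> nonempty_intersections (maximal_cliques G)"
  then obtain S where S: "Y = \<Inter>S" "S \<noteq> {}" "S \<subseteq> maximal_cliques G" "\<Inter>S \<noteq> {}"
    unfolding nonempty_intersections_def by blast
  have "S \<subseteq> cluster ` (V - X)" using S root_internal unfolding maximal_cliques_eq by blast
  moreover from this have "finite S" using finite_V by (meson finite_Diff finite_imageI finite_subset)
  ultimately show "Y \<in> cluster ` (V - X)" using cluster_Inter S by blast
qed

lemma d_outside:
  assumes "x \<in> cluster v" "y \<in> cluster v" "z \<in> X - cluster v"
  shows "d x z = d y z \<or> d x z = odot \<or> d y z = odot"
proof (rule ccontr)
  assume no: "\<not> ?thesis"
  have X: "x \<in> X" "y \<in> X" "z \<in> X" "x \<noteq> z" "y \<noteq> z" using assms cluster_subset by blast+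
  then obtain w w' where w: "lowest_common x z w" "lowest_common y z w'"
    using no d_odot_iff lowest_common_exists by metis
  obtain m where m: "lowest_common x y m"
    using assms lowest_common_exists unfolding cluster_def by blast
  then have "v \<preceq> m" using assms unfolding cluster_def lowest_common_def by blast
  then have "\<not> m \<preceq> z" using assms unfolding cluster_def by (auto intro: rtrancl_trans)
  then have "w = w'" using lowest_common_outside m w by blast
  then show False using no d_lca w X by metis
qed

lemma clique_module_in_cluster:
  assumes "Y \<noteq> {}" "Y \<subseteq> cluster v"
    and same: "\<And>x y z. x \<in> Y \<Longrightarrow> y \<in> Y \<Longrightarrow> z \<in> cluster v - Y \<Longrightarrow> d x z = d y z"
  shows "clique_module odot X d Y"
proof -
  have "finite Y" using assms finite_cluster finite_subset by blast
  then have "card Y = 1 \<or> card Y \<ge> 2"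
    using assms(1) by (metis One_nat_def Suc_1 card_gt_0_iff less_one linorder_not_less not_less_eq_eq order_antisym)
  moreover have "card {d x z, d y z, odot} \<le> 2" if "x \<in> Y" "y \<in> Y" "z \<in> X - Y" for x y z
    unfolding card_triple_le_2 using d_outside[of x v y z] same[of x y z] that assms(2) by blast
  ultimately show ?thesis
    using assms(1,2) cluster_subset clique_in_cluster unfolding clique_module_def by blast
qed

lemma clique_module_cluster: "v \<in> V \<Longrightarrow> clique_module odot X d (cluster v)"
  using cluster_nonempty by (intro clique_module_in_cluster[of _ v]) auto

lemma clique_module_children:
  assumes "(v, a) \<in> E" "(v, b) \<in> E"
  shows "clique_module odot X d (cluster a \<union> cluster b)"
proof (rule clique_module_in_cluster[of _ v])
  show "cluster a \<union> cluster b \<noteq> {}" using assms E_V cluster_nonempty by blast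
  show "cluster a \<union> cluster b \<subseteq> cluster v" using assms cluster_child by blast
  fix x y z
  assume xy: "x \<in> cluster a \<union> cluster b" "y \<in> cluster a \<union> cluster b"
    and z: "z \<in> cluster v - (cluster a \<union> cluster b)"
  obtain c where c: "(v, c) \<in> E" "z \<in> cluster c"
    using z parent_internal[OF assms(1)] by (auto elim: cluster_child_cases)
  have "c \<noteq> a" "c \<noteq> b" using c z by blast+
  then have "d x z = t v" "d y z = t v" using d_children c xy assms by blast+
  then show "d x z = d y z" by simp
qed

lemma clique_module_grandchild:
  assumes "(u, v) \<in> E" "(u, u') \<in> E" "u' \<noteq> v" "(v, a) \<in> E" "t u = t v"
  shows "clique_module odot X d (cluster u' \<union> cluster a)"
proof (rule clique_module_in_cluster[of _ u])
  show "cluster u' \<union> cluster a \<noteq> {}" using assms E_V cluster_nonempty by blast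
  show sub: "cluster u' \<union> cluster a \<subseteq> cluster u" using assms cluster_child by blast
  have "d x z = t u"
    if x: "x \<in> cluster u' \<union> cluster a" and z: "z \<in> cluster u - (cluster u' \<union> cluster a)" for x z
  proof -
    obtain c where c: "(u, c) \<in> E" "z \<in> cluster c"
      using z parent_internal[OF assms(1)] by (auto elim: cluster_child_cases)
    have cu: "c \<noteq> u'" using c z by blast
    have xv: "x \<in> cluster u' \<or> x \<in> cluster v" using x assms cluster_child by blast
    show ?thesis
    proof (cases "c = v \<and> x \<in> cluster a")
      case True
      then obtain b where b: "(v, b) \<in> E" "z \<in> cluster b"
        using c parent_internal[OF assms(4)] by (auto elim: cluster_child_cases)
      then have "b \<noteq> a" using z by blast
      then show ?thesis using d_children[of v a b x z] b True assms by simp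
    next
      case False
      then show ?thesis
        using d_children[of u u' c x z] d_children[of u v c x z] xv x c cu assms by blast
    qed
  qed
  then show "d x z = d y z" if "x \<in> cluster u' \<union> cluster a" "y \<in> cluster u' \<union> cluster a"
    "z \<in> cluster u - (cluster u' \<union> cluster a)" for x y z
    using that by metis
qed

lemma nontrivial_clique:
  assumes "clique_module odot X d Y" "card Y \<noteq> 1"
  shows "clique G Y"
  using assms unfolding clique_module_def by blast

lemma clique_lowest_common:
  assumes "clique G Y"
  obtains v where "v \<in> V" "Y \<subseteq> cluster v" "\<And>w. (v, w) \<in> E \<Longrightarrow> \<not> Y \<subseteq> cluster w"
proof -
  obtain r where r: "is_root r" "Y \<subseteq> cluster r" using assms by (rule cliqueE)
  have "wf (E\<inverse>)" using finite_acyclic_wf_converse[OF finite_E acyclic_E] .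
  then obtain v where "v \<in> {v \<in> V. Y \<subseteq> cluster v}"
    "\<And>w. (w, v) \<in> E\<inverse> \<Longrightarrow> w \<notin> {v \<in> V. Y \<subseteq> cluster v}"
    using wfE_min[of "E\<inverse>" r "{v \<in> V. Y \<subseteq> cluster v}"] r is_root_def by auto
  then show ?thesis using that E_V by blast
qed

lemma strong_modules_subset:
  "strong_nontrivial_clique_modules odot X d \<subseteq> cluster ` (V - X)"
proof
  fix Y assume "Y \<in> strong_nontrivial_clique_modules odot X d"
  then have mod: "clique_module odot X d Y" and nt: "card Y \<noteq> 1"
    and strong: "\<And>Z. clique_module odot X d Z \<Longrightarrow> clique G (Y \<union> Z) \<Longrightarrow> Y \<inter> Z \<in> {Y, Z, {}}"
    unfolding strong_nontrivial_clique_modules_def strong_clique_module_def by blast+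
  have cl: "clique G Y" using nontrivial_clique mod nt by blast
  obtain v where v: "v \<in> V" "Y \<subseteq> cluster v" "\<And>w. (v, w) \<in> E \<Longrightarrow> \<not> Y \<subseteq> cluster w"
    using clique_lowest_common[OF cl] by metis
  have card2: "card Y \<ge> 2" using cl unfolding clique_iff by blast
  have strong': "Y \<inter> Z \<in> {Y, Z, {}}" if Z: "clique_module odot X d Z" "Z \<subseteq> cluster v" for Z
  proof (rule strong[OF Z(1)])
    have "card (Y \<union> Z) \<ge> card Y"
      using v Z finite_cluster by (intro card_mono) (auto intro: finite_subset)
    then show "clique G (Y \<union> Z)" using clique_in_cluster[of "Y \<union> Z" v] v Z card2 by simp
  qed
  have vX: "v \<notin> X"
  proof
    assume "v \<in> X"
    then have "cluster v \<subseteq> {v}" using leaf_descendant unfolding cluster_def by blast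
    then have "card Y \<le> card {v}" using v by (intro card_mono) auto
    then show False using card2 by simp
  qed
  have "Y = cluster v"
  proof (rule ccontr)
    assume "Y \<noteq> cluster v"
    then obtain z where z: "z \<in> cluster v" "z \<notin> Y" using v by blast
    obtain j where j: "(v, j) \<in> E" "z \<in> cluster j" using z vX by (auto elim: cluster_child_cases)
    have "cluster j \<inter> Y = {}"
      using strong'[OF clique_module_cluster, of j] E_V j v z cluster_child[OF j(1)] by blast
    obtain x where x: "x \<in> Y" using card2 by fastforce
    then have "x \<in> cluster v" using v(2) by blast
    then obtain i where i: "(v, i) \<in> E" "x \<in> cluster i" using vX by (auto elim: cluster_child_cases)
    have "Y \<inter> (cluster i \<union> cluster j) \<in> {Y, cluster i \<union> cluster j, {}}"
      using strong'[OF clique_module_children[OF i(1) j(1)]] i j cluster_child by blast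
    then have "Y \<subseteq> cluster i \<union> cluster j" using x z i j by blast
    then show False using v(3)[OF i(1)] \<open>cluster j \<inter> Y = {}\<close> by blast
  qed
  then show "Y \<in> cluster ` (V - X)" using v vX by blast
qed

definition discr :: bool where
  "discr \<longleftrightarrow>
     (\<forall>u v. (u, v) \<in> E \<longrightarrow> v \<notin> X \<longrightarrow> (\<exists>v'. v' \<noteq> v \<and> (u, v') \<in> E)) \<and>
     (\<forall>u v. (u, v) \<in> E \<longrightarrow> v \<notin> X \<longrightarrow> (\<forall>u'. (u', v) \<in> E \<longrightarrow> u' = u) \<longrightarrow> t u \<noteq> t v)"

lemma inj_on_cluster:
  assumes discr
  shows "inj_on cluster (V - X)"
proof -
  have below: "u = w" if u: "u \<preceq> w" "cluster u = cluster w" "w \<notin> X" for u w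
  proof (rule ccontr)
    assume "u \<noteq> w"
    then obtain c where c: "(u, c) \<in> E" "c \<preceq> w" using u ancestor_child by blast
    then have "c \<notin> X" using u leaf_descendant by blast
    then obtain c' where "c' \<noteq> c" "(u, c') \<in> E" using c assms unfolding discr_def by blast
    then have "cluster c \<subset> cluster u" using child_cluster_psubset c by blast
    then show False using u cluster_mono[OF c(2)] by blast
  qed
  show ?thesis
  proof (rule inj_onI)
    fix u v assume uv: "u \<in> V - X" "v \<in> V - X" "cluster u = cluster v"
    obtain x where "x \<in> cluster u" using uv cluster_nonempty by blast
    then have "u \<preceq> x" "v \<preceq> x" using uv unfolding cluster_def by blast+
    then obtain w where w: "w \<in> V - X" "\<And>y. (u \<preceq> y \<and> v \<preceq> y) \<longleftrightarrow> w \<preceq> y"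
      using common_descendants_internal[OF uv(1,2)] by metis
    have uw: "u \<preceq> w" "v \<preceq> w" using w by blast+
    have "cluster w = cluster u" using w uv unfolding cluster_def by blast
    then show "u = v" using below uw w(1) uv by (metis DiffD2)
  qed
qed

lemma hybrid_cluster:
  assumes "(p, v) \<in> E" "(q, v) \<in> E" "p \<noteq> q"
  shows "cluster v \<in> nonempty_intersections (maximal_cliques G)"
proof -
  have V: "p \<in> V" "q \<in> V" "v \<in> V" using assms E_V by blast+
  obtain r where r: "is_root r" "r \<preceq> p" using root_above V by blast
  obtain s where s: "is_root s" "s \<preceq> q" using root_above V by blast
  have rv: "r \<preceq> v" "s \<preceq> v" using r s assms by (meson rtrancl.rtrancl_into_rtrancl)+
  then obtain w where w: "\<And>y. (r \<preceq> y \<and> s \<preceq> y) \<longleftrightarrow> w \<preceq> y"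
    using common_descendants by metis
  have "w = v"
  proof (rule ccontr)
    assume "w \<noteq> v"
    moreover have "w \<preceq> v" using w rv by blast
    ultimately obtain c where c: "w \<preceq> c" "(c, v) \<in> E" using ancestor_parent by blast
    then have "r \<preceq> c" "s \<preceq> c" using w by blast+
    then have "c = p" "c = q" using parents_eq[of r] parents_eq[of s] r s c assms by blast+
    then show False using assms by blast
  qed
  then have "cluster v = \<Inter>{cluster r, cluster s}" using w unfolding cluster_def by auto
  moreover have "{cluster r, cluster s} \<subseteq> maximal_cliques G"
    unfolding maximal_cliques_eq using r s by blast
  ultimately show ?thesis
    using cluster_nonempty[OF V(3)] unfolding nonempty_intersections_def by blast
qed

lemma root_cluster:
  assumes "is_root r"
  shows "cluster r \<in> nonempty_intersections (maximal_cliques G)"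
proof -
  have "cluster r = \<Inter>{cluster r}" by simp
  moreover have "{cluster r} \<subseteq> maximal_cliques G" unfolding maximal_cliques_eq using assms by blast
  moreover have "cluster r \<noteq> {}" using assms cluster_nonempty unfolding is_root_def by blast
  ultimately show ?thesis unfolding nonempty_intersections_def by blast
qed

lemma tree_vertex_cluster:
  assumes disc: discr and uv: "(u, v) \<in> E" "\<And>u'. (u', v) \<in> E \<Longrightarrow> u' = u" and vX: "v \<notin> X"
  shows "cluster v \<in> strong_nontrivial_clique_modules odot X d"
proof -
  have V: "u \<in> V" "v \<in> V" using uv E_V by blast+
  obtain v1 v2 where v12: "(v, v1) \<in> E" "(v, v2) \<in> E" "v1 \<noteq> v2"
    using internal_child[of v] V vX no_suppressible[OF uv(1)] uv(2) by blast
  obtain u' where u': "(u, u') \<in> E" "u' \<noteq> v" using disc uv vX unfolding discr_def by blast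
  have tuv: "t u \<noteq> t v" using disc uv vX unfolding discr_def by blast
  have card2: "card (cluster v) \<ge> 2" using branching_card v12 by blast
  have "cluster v \<inter> Y \<in> {cluster v, Y, {}}"
    if Y: "clique_module odot X d Y" "clique G (cluster v \<union> Y)" for Y
  proof (rule ccontr)
    assume "\<not> ?thesis"
    then obtain a b c where abc: "a \<in> cluster v" "a \<notin> Y" "b \<in> Y" "b \<notin> cluster v"
      "c \<in> cluster v" "c \<in> Y" by blast
    then have "\<not> is_singleton Y" by (auto simp: is_singleton_def)
    then have "card Y \<noteq> 1" by (simp add: is_singleton_altdef)
    then have mod: "\<And>x y z. x \<in> Y \<Longrightarrow> y \<in> Y \<Longrightarrow> z \<in> X - Y \<Longrightarrow> d x z = d y z \<or> d x z = odot \<or> d y z = odot"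
      using Y(1) unfolding clique_module_def card_triple_le_2 by blast
    obtain r where r: "is_root r" "cluster v \<union> Y \<subseteq> cluster r" using Y(2) by (rule cliqueE)
    have rX: "cluster r \<subseteq> X" by (rule cluster_subset)
    have nz: "d x y \<noteq> odot" if "x \<in> cluster r" "y \<in> cluster r" "x \<noteq> y" for x y
      using d_odot_iff[of x y] that unfolding cluster_def by blast
    have modr: "d x z = d y z" if "x \<in> Y" "y \<in> Y" "z \<in> cluster r" "z \<notin> Y" for x y z
      using mod[of x y z] nz[of x z] nz[of y z] that r rX by blast
    have "r \<preceq> v" using branching_ancestor[OF v12] r by blast
    moreover have "r \<noteq> v" using abc r uv is_root_def by blast
    ultimately have ru: "r \<preceq> u" using ancestor_parent uv by blast
    obtain w where w: "lowest_common c b w"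
      using lowest_common_exists abc r unfolding cluster_def by blast
    have rw: "r \<preceq> w" using w abc r unfolding lowest_common_def cluster_def by blast
    have bX: "b \<in> X" using abc r rX by blast
    have vb: "\<not> v \<preceq> b" using abc bX unfolding cluster_def by blast
    have "w \<preceq> v"
    proof -
      have "\<not> v \<preceq> w" using w vb unfolding lowest_common_def by (meson rtrancl_trans)
      then show ?thesis
        using ancestors_comparable[OF \<open>r \<preceq> v\<close> _ rw, of c] w abc
        unfolding lowest_common_def cluster_def by blast
    qed
    have "w \<noteq> v" using w vb unfolding lowest_common_def by blast
    then have wu: "w \<preceq> u" using \<open>w \<preceq> v\<close> ancestor_parent uv by blast
    have "d x b = t w" if x: "x \<in> cluster v" for x
    proof -
      have "x \<in> cluster r" using x r by blast
      then obtain w' where w': "lowest_common x b w'"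
        using lowest_common_exists abc r unfolding cluster_def by blast
      obtain m where m: "lowest_common c x m"
        using lowest_common_exists abc x unfolding cluster_def by blast
      have "v \<preceq> m" using m abc x unfolding lowest_common_def cluster_def by blast
      then have "\<not> m \<preceq> b" using vb by (meson rtrancl_trans)
      then have "w = w'" using lowest_common_outside m w w' by blast
      then show ?thesis using d_lca[of x b w] w' x abc bX cluster_subset by blast
    qed note db = this
    have dY: "d c' a' = t w" if a': "a' \<in> cluster v" "a' \<notin> Y" "c' \<in> Y" for a' c'
    proof -
      have "a' \<in> cluster r" "a' \<in> X" "a' \<noteq> b" using a' abc r rX by blast+
      then show ?thesis
        using modr[of b c' a'] db[of a'] d_commute[of a' b] a' abc bX by metis
    qed
    have tvw: "t v = t w"
    proof -
      obtain k where k: "(v, k) \<in> E" "a \<in> cluster k" using abc vX by (auto elim: cluster_child_cases)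
      obtain l where l: "(v, l) \<in> E" "c \<in> cluster l" using abc vX by (auto elim: cluster_child_cases)
      show ?thesis
      proof (cases "k = l")
        case False
        then show ?thesis using d_children[of v l k c a] k l dY[of a c] abc by auto
      next
        case True
        obtain j where j: "(v, j) \<in> E" "j \<noteq> k" using v12 by blast
        then obtain e where e: "e \<in> cluster j" using E_V cluster_nonempty by blast
        then have ev: "e \<in> cluster v" using cluster_child j by blast
        show ?thesis
        proof (cases "e \<in> Y")
          case True
          then show ?thesis using d_children[of v j k e a] k j e dY[of a e] abc by auto
        next
          case False
          then show ?thesis using d_children[of v l j c e] l j e dY[of e c] abc ev \<open>k = l\<close> by auto
        qed
      qed
    qed
    obtain e where e: "e \<in> cluster u'" using u' E_V cluster_nonempty by blast
    have eu: "e \<in> cluster u" using e u' cluster_child by blast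
    have er: "e \<in> cluster r" using eu ru cluster_mono by blast
    have de: "d e x = t u" "d x e = t u" if "x \<in> cluster v" for x
      using d_children[OF u'(1) uv(1) u'(2) e that] d_children[OF uv(1) u'(1) _ that e] u'(2) by auto
    show False
    proof (cases "e \<in> Y")
      case True
      then show False using dY[of a e] de(1)[of a] abc tuv tvw by simp
    next
      case False
      then have "d b e = t u" using modr[of b c e] de(2)[of c] abc er by simp
      have "w \<noteq> u"
        using tuv tvw by auto
      have "\<not> u \<preceq> b"
      proof
        assume "u \<preceq> b"
        then have "u \<preceq> w" using w abc uv(1) unfolding lowest_common_def cluster_def
          by (auto intro: converse_rtrancl_into_rtrancl)
        then show False using wu \<open>w \<noteq> u\<close> ancestor_antisym by blast
      qed
      obtain w' where w': "lowest_common e b w'"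
        using lowest_common_exists er abc r unfolding cluster_def by blast
      have "lowest_common c e u"
        using lowest_common_clusters[OF uv(1) u'(1) _ abc(5) e] u'(2) by blast
      then have "w = w'" using lowest_common_outside[OF _ \<open>\<not> u \<preceq> b\<close> w w'] by blast
      have "e \<noteq> b" using False abc by blast
      then have "d e b = t w" using d_lca[of e b w] w' \<open>w = w'\<close> er bX rX by blast
      then have "d b e = t w" using d_commute[of e b] \<open>e \<noteq> b\<close> er bX rX by auto
      then show False using \<open>d b e = t u\<close> tuv tvw by simp
    qed
  qed
  then show ?thesis
    using clique_module_cluster[OF V(2)] card2
    unfolding strong_nontrivial_clique_modules_def strong_clique_module_def by auto
qed

lemma discr_imp_bij:
  assumes discr
  shows "bij_betw cluster (V - X)
    (nonempty_intersections (maximal_cliques G) \<union> strong_nontrivial_clique_modules odot X d)"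
proof -
  have "cluster v \<in> nonempty_intersections (maximal_cliques G) \<union> strong_nontrivial_clique_modules odot X d"
    if v: "v \<in> V - X" for v
  proof (cases "is_root v")
    case True
    then show ?thesis using root_cluster by blast
  next
    case False
    then obtain u where u: "(u, v) \<in> E" using v unfolding is_root_def by blast
    then show ?thesis
      using hybrid_cluster[of _ v u] tree_vertex_cluster[OF assms u] v by blast
  qed
  then show ?thesis
    using inj_on_cluster[OF assms] nonempty_intersections_subset strong_modules_subset
    unfolding bij_betw_def by blast
qed

lemma bij_imp_discr:
  assumes "bij_betw cluster (V - X)
    (nonempty_intersections (maximal_cliques G) \<union> strong_nontrivial_clique_modules odot X d)"
  shows discr
proof -
  have branch: "\<exists>v'. v' \<noteq> v \<and> (u, v') \<in> E" if uv: "(u, v) \<in> E" "v \<notin> X" for u v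
  proof (rule ccontr)
    assume "\<not> ?thesis"
    then have "cluster u = cluster v" using only_child_cluster uv by blast
    moreover have "u \<in> V - X" "v \<in> V - X" using uv parent_internal E_V by blast+
    ultimately have "u = v" using assms unfolding bij_betw_def inj_on_def by blast
    then show False using uv arc_not_back by blast
  qed
  have "t u \<noteq> t v" if uv: "(u, v) \<in> E" "v \<notin> X" "\<forall>u'. (u', v) \<in> E \<longrightarrow> u' = u" for u v
  proof
    assume t: "t u = t v"
    have vV: "v \<in> V - X" using uv E_V by blast
    obtain v1 v2 where v12: "(v, v1) \<in> E" "(v, v2) \<in> E" "v1 \<noteq> v2"
      using internal_child[OF vV] no_suppressible[OF uv(1,3)] by blast
    obtain u' where u': "u' \<noteq> v" "(u, u') \<in> E" using branch uv by blast
    have sub: "cluster v \<subset> cluster u" using child_cluster_psubset uv u' by blast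
    have "cluster v \<notin> nonempty_intersections (maximal_cliques G)"
    proof
      assume "cluster v \<in> nonempty_intersections (maximal_cliques G)"
      then obtain S where S: "cluster v = \<Inter>S" "S \<subseteq> cluster ` {r. is_root r}"
        unfolding nonempty_intersections_def maximal_cliques_eq by blast
      have "cluster u \<subseteq> Y" if Y: "Y \<in> S" for Y
      proof -
        obtain r where r: "is_root r" "Y = cluster r" using Y S by blast
        then have "r \<preceq> v" using branching_ancestor[OF v12] S(1) Y by blast
        moreover have "r \<noteq> v" using r uv(1) unfolding is_root_def by blast
        ultimately have "r \<preceq> u" using ancestor_parent uv(3) by blast
        then show ?thesis using cluster_mono r by blast
      qed
      then show False using sub S(1) by blast
    qed
    moreover have "cluster v \<notin> strong_nontrivial_clique_modules odot X d"
    proof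
      let ?Y = "cluster u' \<union> cluster v1"
      assume "cluster v \<in> strong_nontrivial_clique_modules odot X d"
      then have strong: "\<And>Z. clique_module odot X d Z \<Longrightarrow> clique G (cluster v \<union> Z) \<Longrightarrow> cluster v \<inter> Z \<in> {cluster v, Z, {}}"
        unfolding strong_nontrivial_clique_modules_def strong_clique_module_def by blast
      have ne: "cluster u' \<noteq> {}" "cluster v1 \<noteq> {}" using u' v12 E_V cluster_nonempty by blast+
      have disj: "cluster u' \<inter> cluster v = {}" using children_clusters_disjoint u' uv by blast
      have v1: "cluster v1 \<subset> cluster v" using child_cluster_psubset v12 by blast
      have "card (cluster v) \<le> card (cluster v \<union> ?Y)"
        using finite_cluster by (intro card_mono) auto
      then have "clique G (cluster v \<union> ?Y)"
        using branching_card[OF v12] cluster_child[OF uv(1)] cluster_child[OF u'(2)] v1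
        by (intro clique_in_cluster[of _ u]) auto
      then have "cluster v \<inter> ?Y \<in> {cluster v, ?Y, {}}"
        using strong clique_module_grandchild[OF uv(1) u'(2,1) v12(1) t] by blast
      then show False using ne disj v1 by blast
    qed
    ultimately show False using assms vV unfolding bij_betw_def by blast
  qed
  then show ?thesis using branch unfolding discr_def by blast
qed

end

section \<open>From arboreal networks to polytrees\<close>

lemma parcs_mk_symmetric_conv: "parcs (mk_symmetric N) = arcs_ends N \<union> (arcs_ends N)\<inverse>"
  by (auto simp: parcs_mk_symmetric arcs_ends_conv)

lemma (in wf_digraph) acyclic_arcs_ends:
  assumes "\<nexists>p. cycle p"
  shows "acyclic (arcs_ends G)"
  unfolding acyclic_def
proof (intro allI notI)
  fix v assume "v \<rightarrow>\<^sup>+ v"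
  then obtain p where "awalk v p v" "p \<noteq> []" using reachable1_awalk by blast
  then have "closed_w p" unfolding closed_w_def by blast
  then show False using assms closed_w_imp_cycle by blast
qed

lemma undirected_tree_bridge:
  assumes "wf_digraph N" "acyclic (arcs_ends N)" "undirected_tree N" "(u, v) \<in> arcs_ends N"
  shows "(u, v) \<notin> ((arcs_ends N - {(u, v)}) \<union> (arcs_ends N - {(u, v)})\<inverse>)\<^sup>*"
    (is "_ \<notin> ?R\<^sup>*")
proof
  interpret S: pair_wf_digraph "mk_symmetric N"
    using assms(1) by (rule wf_digraph.wellformed_mk_symmetric)
  have vu: "(v, u) \<notin> arcs_ends N"
    using assms(2,4) unfolding acyclic_def by (meson trancl.simps)
  have "u \<noteq> v" using assms(2,4) unfolding acyclic_def by (meson trancl.simps)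
  have uv: "(u, v) \<in> parcs (mk_symmetric N)" using assms(4) by (simp add: parcs_mk_symmetric_conv)
  assume "(u, v) \<in> ?R\<^sup>*"
  moreover have "sym (?R\<^sup>*)" by (intro sym_rtrancl) (auto simp: sym_def)
  ultimately have vR: "(v, u) \<in> ?R\<^sup>*" by (auto dest: symD)
  have "\<exists>p. S.awalk v p w \<and> (v, u) \<notin> set p" if "(v, w) \<in> ?R\<^sup>*" for w
    using that
  proof (induction rule: rtrancl_induct)
    case base
    have "S.awalk v [] v" using S.in_arcsD2[OF uv] by (simp add: S.awalk_Nil_iff)
    then show ?case by (intro exI[of _ "[]"]) simp
  next
    case (step y z)
    from step.IH obtain p where p: "S.awalk v p y" "(v, u) \<notin> set p" by metis
    have "(y, z) \<in> parcs (mk_symmetric N)" "(y, z) \<noteq> (v, u)"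
      using step.hyps(2) vu by (auto simp: parcs_mk_symmetric_conv)
    moreover from this have "S.awalk y [(y, z)] z"
      using S.in_arcsD2 by (auto simp: S.awalk_Cons_iff S.awalk_Nil_iff)
    ultimately show ?case using p by (intro exI[of _ "p @ [(y, z)]"]) auto
  qed
  from this[OF vR] obtain p where p: "S.awalk v p u" "(v, u) \<notin> set p" by metis
  define q where "q = S.awalk_to_apath p"
  have q: "S.apath v q u" "(v, u) \<notin> set q"
    using S.apath_awalk_to_apath[OF p(1)] S.awalk_to_apath_subset[OF p(1)] p(2)
    unfolding q_def by blast+
  then have qw: "S.awalk v q u" "distinct (pawalk_verts v q)" unfolding S.apath_def by auto
  have "length q \<ge> 2"
  proof (rule ccontr)
    assume "\<not> ?thesis"
    then consider "q = []" | e where "q = [e]"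
      by (cases q; cases "tl q") auto
    then show False
      using qw(1) q(2) \<open>u \<noteq> v\<close> by cases (auto simp: S.awalk_Cons_iff S.awalk_Nil_iff)
  qed
  moreover have "S.cycle ((u, v) # q)"
    unfolding S.cycle_def using qw uv by (auto simp: S.awalk_Cons_iff)
  ultimately show False using assms(3) unfolding undirected_tree_def
    by (metis One_nat_def Suc_le_mono length_Cons numeral_2_eq_2 numeral_3_eq_3)
qed

lemma (in nomulti_digraph) out_degree_conv: "out_degree G v = card {w. v \<rightarrow>\<^bsub>G\<^esub> w}"
proof -
  have "inj_on (head G) (out_arcs G v)"
    using no_multi_arcs by (auto simp: inj_on_def arc_to_ends_def)
  moreover have "head G ` out_arcs G v = {w. v \<rightarrow>\<^bsub>G\<^esub> w}"
    by (auto simp: arcs_ends_conv image_iff)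
  ultimately show ?thesis unfolding out_degree_def by (metis card_image)
qed

lemma (in nomulti_digraph) in_degree_conv: "in_degree G v = card {u. u \<rightarrow>\<^bsub>G\<^esub> v}"
proof -
  have "inj_on (tail G) (in_arcs G v)"
    using no_multi_arcs by (auto simp: inj_on_def arc_to_ends_def)
  moreover have "tail G ` in_arcs G v = {u. u \<rightarrow>\<^bsub>G\<^esub> v}"
    by (auto simp: arcs_ends_conv image_iff)
  ultimately show ?thesis unfolding in_degree_def by (metis card_image)
qed

lemma card_Collect_eq_1_iff: "card {x. P x} = 1 \<longleftrightarrow> (\<exists>!x. P x)"
proof -
  have "card {x. P x} = 1 \<longleftrightarrow> (\<exists>x. {x. P x} = {x})" by (simp add: card_1_singleton_iff)
  then show ?thesis by (auto simp: set_eq_iff)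
qed

lemma card_ge_2_iff: "finite A \<Longrightarrow> 2 \<le> card A \<longleftrightarrow> (\<exists>a\<in>A. \<exists>b\<in>A. a \<noteq> b)"
  using card_le_Suc0_iff_eq[of A] by (auto simp: not_less_eq_eq[symmetric] numeral_2_eq_2)

theorem theorem9p5:
  fixes X :: "'v set" and M :: "'m set" and odot :: 'm
    and N :: "('v, 'e) pre_digraph" and t :: "'v \<Rightarrow> 'm" and d :: "'v \<Rightarrow> 'v \<Rightarrow> 'm"
  assumes "finite X" and "card X \<ge> 2"
    and "M \<noteq> {}" and "odot \<notin> M"
    and "labelled_arboreal_network X M N t"
    and "d = network_map odot N t"
  shows "discriminating N t \<longleftrightarrow>
    bij_betw (leaves_below N) (verts N - X)
      (nonempty_intersections (maximal_cliques (map_graph odot X d))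
        \<union> strong_nontrivial_clique_modules odot X d)"
proof -
  define E where "E = arcs_ends N"
  have net: "network X N" and tree: "undirected_tree N"
    and tM: "t \<in> {v \<in> verts N. out_degree N v \<ge> 2} \<rightarrow> M"
    using assms(5) unfolding labelled_arboreal_network_def arboreal_network_def by auto
  interpret digraph N using net unfolding network_def by blast
  have acyc: "acyclic E" and leaves: "leaves N = X"
    and roots: "\<And>v. v \<in> verts N \<Longrightarrow> in_degree N v = 0 \<Longrightarrow> out_degree N v \<ge> 2"
    and sinks: "\<And>v. v \<in> verts N \<Longrightarrow> out_degree N v = 0 \<Longrightarrow> in_degree N v = 1"
    and no11: "\<And>v. v \<in> verts N \<Longrightarrow> \<not> (in_degree N v = 1 \<and> out_degree N v = 1)"
    using net acyclic_arcs_ends unfolding network_def E_def by auto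
  have finE: "finite E" unfolding E_def arcs_ends_def by simp
  have EV: "E \<subseteq> verts N \<times> verts N" unfolding E_def using adj_in_verts by auto
  have fin: "finite {w. (v, w) \<in> E}" "finite {u. (u, v) \<in> E}" for v
    using EV by (auto intro: finite_subset[OF _ finite_verts])
  have out0: "out_degree N v = 0 \<longleftrightarrow> (\<forall>w. (v, w) \<notin> E)" for v
    unfolding out_degree_conv using fin by (auto simp: E_def)
  have in0: "in_degree N v = 0 \<longleftrightarrow> (\<forall>u. (u, v) \<notin> E)" for v
    unfolding in_degree_conv using fin by (auto simp: E_def)
  have out1: "out_degree N v = 1 \<longleftrightarrow> (\<exists>!w. (v, w) \<in> E)" for v
    unfolding out_degree_conv card_Collect_eq_1_iff E_def ..
  have in1: "in_degree N v = 1 \<longleftrightarrow> (\<exists>!u. (u, v) \<in> E)" for v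
    unfolding in_degree_conv card_Collect_eq_1_iff E_def ..
  have out2: "out_degree N v \<ge> 2 \<longleftrightarrow> (\<exists>a b. a \<noteq> b \<and> (v, a) \<in> E \<and> (v, b) \<in> E)" for v
    using card_ge_2_iff[OF fin(1)] unfolding out_degree_conv E_def by auto
  have X_eq: "X = {v \<in> verts N. \<forall>w. (v, w) \<notin> E}"
    using leaves sinks unfolding leaves_def out0 by auto
  interpret P: polytree E
    using undirected_tree_bridge[OF wf_digraph acyc[unfolded E_def] tree] finE acyc
    by unfold_locales (auto simp: E_def)
  have reach: "v \<rightarrow>\<^sup>*\<^bsub>N\<^esub> x \<longleftrightarrow> (v, x) \<in> E\<^sup>*" if "x \<in> verts N" for v x
  proof
    assume "(v, x) \<in> E\<^sup>*"
    moreover from this have "v \<in> verts N"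
      using that EV by (induction rule: converse_rtrancl_induct) auto
    ultimately show "v \<rightarrow>\<^sup>*\<^bsub>N\<^esub> x" by (simp add: reachable_conv' E_def)
  qed (simp add: E_def reachable_rtranclI)
  have ca: "common_ancestor N x y v \<longleftrightarrow> (v, x) \<in> E\<^sup>* \<and> (v, y) \<in> E\<^sup>*"
    if "x \<in> X" "y \<in> X" for x y v
    using that X_eq reach unfolding common_ancestor_def by auto
  have is_lca: "is_lca N x y m \<longleftrightarrow> P.lowest_common x y m" if "x \<in> X" "y \<in> X" for x y m
    unfolding is_lca_def ca[OF that] E_def[symmetric] P.lowest_common_iff by blast
  interpret L: labelled_polytree E "verts N" X t odot d
  proof unfold_locales
    show "\<exists>!u. (u, x) \<in> E" if "x \<in> X" for x
      using that leaves in1 unfolding leaves_def by blast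
    show "\<exists>a b. a \<noteq> b \<and> (v, a) \<in> E \<and> (v, b) \<in> E" if "v \<in> verts N" "\<forall>u. (u, v) \<notin> E" for v
      using roots that in0 out2 by blast
    show "\<exists>w'. w' \<noteq> w \<and> (v, w') \<in> E"
      if "(u, v) \<in> E" "\<forall>u'. (u', v) \<in> E \<longrightarrow> u' = u" "(v, w) \<in> E" for u v w
    proof -
      have "in_degree N v = 1" unfolding in1 using that by metis
      then have "out_degree N v \<noteq> 1" using no11[of v] that EV by blast
      then show ?thesis unfolding out1 using that(3) by metis
    qed
    show "d x y = t m" if "x \<in> X" "y \<in> X" "x \<noteq> y" "P.lowest_common x y m" for x y m
    proof -
      have "lca N x y = m"
        unfolding lca_def is_lca[OF that(1,2)] using that(4) P.lowest_common_unique by blast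
      moreover have "common_ancestor N x y m"
        using that(4) unfolding ca[OF that(1,2)] P.lowest_common_def by blast
      ultimately show ?thesis unfolding assms(6) network_map_def by auto
    qed
    show "d x y = odot" if "x \<in> X" "y \<in> X" "\<nexists>a. (a, x) \<in> E\<^sup>* \<and> (a, y) \<in> E\<^sup>*" for x y
      using that(3) unfolding assms(6) network_map_def ca[OF that(1,2)] by auto
    show "t v \<noteq> odot" if "(v, a) \<in> E" "(v, b) \<in> E" "a \<noteq> b" for v a b
    proof -
      have "out_degree N v \<ge> 2" "v \<in> verts N" using that out2 EV by blast+
      then have "t v \<in> M" using tM by blast
      then show ?thesis using assms(4) by blast
    qed
  qed (fact finite_verts EV X_eq)+
  have "leaves_below N = L.cluster"
    using reach X_eq unfolding leaves_below_def L.cluster_def leaves by (intro ext) auto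
  moreover have "discriminating N t \<longleftrightarrow> L.discr"
  proof -
    have "internal_arc N u v \<longleftrightarrow> (u, v) \<in> E \<and> v \<notin> X" for u v
      unfolding internal_arc_def leaves using L.parent_internal E_def by blast
    moreover have "out_degree N u \<noteq> 1 \<longleftrightarrow> (\<exists>v'. v' \<noteq> v \<and> (u, v') \<in> E)" if "(u, v) \<in> E" for u v
      unfolding out1 using that by metis
    moreover have "in_degree N v = 1 \<longleftrightarrow> (\<forall>u'. (u', v) \<in> E \<longrightarrow> u' = u)" if "(u, v) \<in> E" for u v
      unfolding in1 using that by metis
    ultimately show ?thesis unfolding discriminating_def L.discr_def by (smt (verit))
  qed
  ultimately show ?thesis using L.discr_imp_bij L.bij_imp_discr by auto
qed

end
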